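(* Let $G=(V,E)$ be a finite undirected graph with $V=[N]$ and $M$ connected components $V_1,\dots,V_M$. Let $P:=\tilde D^{-1/2}\tilde A\tilde D^{-1/2}\in\mathbb{R}^{N\times N}$, with eigenvalues $\lambda_1\le\cdots\le\lambda_N$, where $\lambda_{N-M+1}=\cdots=\lambda_N=1$, and put $\lambda:=\max_{n=1,\dots,N-M}|\lambda_n|$. Let $C\in\mathbb{N}_+$, let $W_l\in\mathbb{R}^{C\times C}$ ($l\in\mathbb{N}_+$), let $s_l$ be the maximum singular value of $W_l$, and assume $s:=\sup_{l\in\mathbb{N}_+}s_l<\infty$. For $X^{(0)}\in\mathbb{R}^{N\times C}$ define $X^{(l)}:=\sigma(PX^{(l-1)}W_l)$ for $l\ge1$. Let $\mathcal{M}:=\{\sum_{m=1}^M e_m\otimes w_m\mid w_m\in\mathbb{R}^C\}$, where $e_m:=\tilde D^{1/2}u_m$. Then for any $X^{(0)}\in\mathbb{R}^{N\times C}$ and any $l$, $$d_{\mathcal{M}}(X^{(l)})\le (s\lambda)^l\, d_{\mathcal{M}}(X^{(0)}).$$ In particular, $d_{\mathcal{M}}(X^{(l)})$ converges exponentially to $0$ as $l\to\infty$ when $s\lambda<1$.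
   Context: $A=(\mathbf{1}_{\{(i,j)\in E\}})_{i,j\in[N]}$ is the adjacency matrix, $D=\mathrm{diag}(\deg(1),\dots,\deg(N))$ with $\deg(i)=|\{j\in V\mid (i,j)\in E\}|$; $\tilde A:=A+I_N$, $\tilde D:=D+I_N$. (So $P=I_N-\tilde\Delta$ where $\tilde\Delta:=I_N-\tilde D^{-1/2}\tilde A\tilde D^{-1/2}$ is the augmented normalized Laplacian.) $u_m=(\mathbf{1}_{\{n\in V_m\}})_{n\in[N]}\in\mathbb{R}^N$ is the indicator vector of $V_m$. The vectors $e_m$ form a basis of the eigenspace of $P$ for the eigenvalue $1$. $\sigma$ is the element-wise ReLU, $\sigma(X)_{nc}=\max(X_{nc},0)$. $(v\otimes w)_{nc}=v_nw_c$. $d_{\mathcal{M}}(X):=\inf\{\|X-Y\|_{\mathrm F}\mid Y\in\mathcal{M}\}$ with $\|\cdot\|_{\mathrm F}$ the Frobenius norm. If $M=N$ the maximum over the empty set defining $\lambda$ is taken to be $0$. *)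

theory Defs
  imports
    "Jordan_Normal_Form.Char_Poly"
    "Graph_Theory.Graph_Theory"
begin

text \<open>
  A graph on \<open>N\<close> nodes is a symmetric \<open>pair_pre_digraph\<close> with vertex set \<open>{0..<N}\<close>,
  since matrix indices start at 0. Undirected graphs have a symmetric arc set, so their
  connected components are the strongly connected components.
\<close>

definition connected_components :: "nat pair_pre_digraph \<Rightarrow> nat set set" where
  "connected_components G = pre_digraph.sccs_verts (with_proj G)"

definition adj_mat :: "nat \<Rightarrow> nat pair_pre_digraph \<Rightarrow> real mat" where
  "adj_mat N G = mat N N (\<lambda>(i, j). if (i, j) \<in> parcs G then 1 else 0)"

definition deg :: "nat pair_pre_digraph \<Rightarrow> nat \<Rightarrow> nat" where
  "deg G i = card {j \<in> pverts G. (i, j) \<in> parcs G}"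

definition deg_mat :: "nat \<Rightarrow> nat pair_pre_digraph \<Rightarrow> real mat" where
  "deg_mat N G = mat_diag N (\<lambda>i. real (deg G i))"

definition aug_adj_mat :: "nat \<Rightarrow> nat pair_pre_digraph \<Rightarrow> real mat" where
  "aug_adj_mat N G = adj_mat N G + 1\<^sub>m N"

definition aug_deg_mat :: "nat \<Rightarrow> nat pair_pre_digraph \<Rightarrow> real mat" where
  "aug_deg_mat N G = deg_mat N G + 1\<^sub>m N"

text \<open>Real power of a diagonal matrix with positive diagonal; off-diagonal entries are ignored.\<close>

definition diag_powr :: "real mat \<Rightarrow> real \<Rightarrow> real mat" where
  "diag_powr A p = mat_diag (dim_row A) (\<lambda>i. A $$ (i, i) powr p)"

definition prop_mat :: "nat \<Rightarrow> nat pair_pre_digraph \<Rightarrow> real mat" where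
  "prop_mat N G =
     diag_powr (aug_deg_mat N G) (- 1 / 2) * aug_adj_mat N G * diag_powr (aug_deg_mat N G) (- 1 / 2)"

text \<open>
  The real eigenvalues in increasing order, repeated according to algebraic multiplicity.
  For a real symmetric matrix these are all the eigenvalues, so there are \<open>dim_row A\<close> of them.
\<close>

definition eigenvalue_list :: "real mat \<Rightarrow> real list" where
  "eigenvalue_list A = sorted_list_of_multiset (proots (char_poly A))"

definition nth_eigenvalue :: "real mat \<Rightarrow> nat \<Rightarrow> real" where
  "nth_eigenvalue A n = eigenvalue_list A ! (n - 1)" \<comment> \<open>numbered from 1\<close>

definition singular_values :: "real mat \<Rightarrow> real set" where
  "singular_values A = sqrt ` {k. eigenvalue (transpose_mat A * A) k}"

definition max_singular_value :: "real mat \<Rightarrow> real" where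
  "max_singular_value A = Max (singular_values A)"

definition frobenius_norm :: "real mat \<Rightarrow> real" where
  "frobenius_norm A = sqrt (\<Sum>i<dim_row A. \<Sum>j<dim_col A. (A $$ (i, j))\<^sup>2)"

definition tensor :: "real vec \<Rightarrow> real vec \<Rightarrow> real mat" where
  "tensor v w = mat (dim_vec v) (dim_vec w) (\<lambda>(n, c). v $ n * w $ c)"

definition indicator_vec :: "nat \<Rightarrow> nat set \<Rightarrow> real vec" where
  "indicator_vec N S = vec N (\<lambda>n. if n \<in> S then 1 else 0)"

definition comp_vec :: "nat \<Rightarrow> nat pair_pre_digraph \<Rightarrow> nat set \<Rightarrow> real vec" where
  "comp_vec N G S = diag_powr (aug_deg_mat N G) (1 / 2) *\<^sub>v indicator_vec N S"

text \<open>
  The components are enumerated as \<open>V 1, \<dots>, V M\<close>. The sum of matrices is taken entrywise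
  because the matrix type, which contains matrices of all dimensions, is not an additive monoid.
\<close>

definition inv_space ::
  "nat \<Rightarrow> nat pair_pre_digraph \<Rightarrow> nat \<Rightarrow> (nat \<Rightarrow> nat set) \<Rightarrow> nat \<Rightarrow> real mat set" where
  "inv_space N G M V C =
     {mat N C (\<lambda>(n, c). \<Sum>m = 1..M. tensor (comp_vec N G (V m)) (w m) $$ (n, c)) | w.
        \<forall>m\<in>{1..M}. w m \<in> carrier_vec C}"

definition dist_to :: "real mat set \<Rightarrow> real mat \<Rightarrow> real" where
  "dist_to S X = Inf {frobenius_norm (X - Y) | Y. Y \<in> S}"

definition relu :: "real mat \<Rightarrow> real mat" where
  "relu X = map_mat (\<lambda>x. max x 0) X"

primrec gcn_layer :: "real mat \<Rightarrow> (nat \<Rightarrow> real mat) \<Rightarrow> real mat \<Rightarrow> nat \<Rightarrow> real mat" where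
  "gcn_layer P W X 0 = X"
| "gcn_layer P W X (Suc l) = relu (P * gcn_layer P W X l * W (Suc l))"

end

theory Submission
  imports "HOL-Analysis.Function_Topology" "HOL-Analysis.Convex" Defs
begin

text \<open>
  Each factor of a layer multiplies the distance to the invariant space by at most its own constant.
  ReLU is 1-Lipschitz and maps the invariant space to itself, because the vectors \<open>e\<^sub>m\<close> are
  nonnegative with disjoint supports. Multiplying by \<open>W\<close> from the right preserves the space and
  costs at most the largest singular value. For \<open>P\<close>, the normalized \<open>e\<^sub>m\<close> are extended to an
  orthonormal eigenbasis; the distance only sees the remaining coordinates, which are scaled by
  the remaining eigenvalues. As no eigenvalue exceeds 1, removing \<open>M\<close> eigenvalues 1 from the
  sorted list removes its last \<open>M\<close> entries, so the remaining ones are those that define \<open>\<lambda>\<close>;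
  the exact multiplicity of the eigenvalue 1 is irrelevant.
\<close>

section \<open>Spectral theorem extending given eigenvectors\<close>

text \<open>Vectors are functions on all natural numbers of which only the values below
  \<open>n\<close> count. This makes the product topology available for the compactness
  argument.\<close>

definition ip :: "nat \<Rightarrow> (nat \<Rightarrow> real) \<Rightarrow> (nat \<Rightarrow> real) \<Rightarrow> real" where
  "ip n f g = (\<Sum>k<n. f k * g k)"

definition matvec :: "nat \<Rightarrow> (nat \<Rightarrow> nat \<Rightarrow> real) \<Rightarrow> (nat \<Rightarrow> real) \<Rightarrow> nat \<Rightarrow> real" where
  "matvec n a f k = (\<Sum>l<n. a k l * f l)"

definition orthonormal :: "nat \<Rightarrow> nat \<Rightarrow> (nat \<Rightarrow> nat \<Rightarrow> real) \<Rightarrow> bool" where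
  "orthonormal n m u \<longleftrightarrow> (\<forall>i<m. \<forall>j<m. ip n (u i) (u j) = of_bool (i = j))"

text \<open>A family with \<open>m < n\<close> is a partial orthonormal eigenbasis still to be
  completed; \<open>m = n\<close> amounts to an orthogonal diagonalization.\<close>

definition eigen_system ::
  "nat \<Rightarrow> nat \<Rightarrow> (nat \<Rightarrow> nat \<Rightarrow> real) \<Rightarrow> (nat \<Rightarrow> nat \<Rightarrow> real) \<Rightarrow> (nat \<Rightarrow> real) \<Rightarrow> bool" where
  "eigen_system n m a u d \<longleftrightarrow>
     orthonormal n m u \<and> (\<forall>i<m. \<forall>k<n. matvec n a (u i) k = d i * u i k)"

section \<open>Algebra of the inner product and of symmetric matrices\<close>

lemma ip_commute: "ip n f g = ip n g f"
  by (simp add: ip_def mult.commute)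

lemma ip_cong: "(\<And>k. k < n \<Longrightarrow> f k = f' k) \<Longrightarrow> (\<And>k. k < n \<Longrightarrow> g k = g' k) \<Longrightarrow> ip n f g = ip n f' g'"
  by (simp add: ip_def)

lemma ip_add_left: "ip n (\<lambda>k. f k + g k) h = ip n f h + ip n g h"
  by (simp add: ip_def sum.distrib algebra_simps)

lemma ip_diff_left: "ip n (\<lambda>k. f k - g k) h = ip n f h - ip n g h"
  by (simp add: ip_def sum_subtractf algebra_simps)

lemma ip_scale_left: "ip n (\<lambda>k. c * f k) h = c * ip n f h"
  by (simp add: ip_def sum_distrib_left mult.assoc)

lemma ip_sum_left: "ip n (\<lambda>k. \<Sum>i\<in>I. f i k) h = (\<Sum>i\<in>I. ip n (f i) h)"
  unfolding ip_def sum_distrib_right by (rule sum.swap)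

lemmas ip_linear_left = ip_add_left ip_diff_left ip_scale_left ip_sum_left

lemma ip_add_right: "ip n h (\<lambda>k. f k + g k) = ip n h f + ip n h g"
  and ip_diff_right: "ip n h (\<lambda>k. f k - g k) = ip n h f - ip n h g"
  and ip_scale_right: "ip n h (\<lambda>k. c * f k) = c * ip n h f"
  and ip_sum_right: "ip n h (\<lambda>k. \<Sum>i\<in>I. F i k) = (\<Sum>i\<in>I. ip n h (F i))"
  using ip_linear_left by (auto simp: ip_commute[of n h])

lemma ip_self_nonneg: "0 \<le> ip n f f"
  by (simp add: ip_def sum_nonneg)

lemma ip_self_eq_0: "ip n f f = 0 \<longleftrightarrow> (\<forall>k<n. f k = 0)"
  by (auto simp: ip_def sum_nonneg_eq_0_iff)

lemma matvec_linear: "matvec n a (\<lambda>l. f l + c * g l) k = matvec n a f k + c * matvec n a g k"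
  by (simp add: matvec_def sum.distrib sum_distrib_left algebra_simps)

lemma ip_matvec: 
  assumes "\<And>i j. i < n \<Longrightarrow> j < n \<Longrightarrow> a i j = a j i"
  shows "ip n f (matvec n a g) = ip n (matvec n a f) g"
proof -
  have "ip n f (matvec n a g) = (\<Sum>k<n. \<Sum>l<n. f k * a k l * g l)"
    by (simp add: ip_def matvec_def sum_distrib_left mult.assoc)
  also have "\<dots> = (\<Sum>l<n. \<Sum>k<n. f k * a k l * g l)"
    by (rule sum.swap)
  also have "\<dots> = (\<Sum>l<n. \<Sum>k<n. a l k * f k * g l)"
    using assms by (intro sum.cong refl) simp
  also have "\<dots> = ip n (matvec n a f) g"
    by (simp add: ip_def matvec_def sum_distrib_right)
  finally show ?thesis .
qed

lemma ip_basis: "k < n \<Longrightarrow> ip n f (\<lambda>l. of_bool (l = k)) = f k"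
  by (simp add: ip_def of_bool_def if_distrib cong: if_cong)

lemma ip_basis_left: "k < n \<Longrightarrow> ip n (\<lambda>l. of_bool (l = k)) f = f k"
  by (simp add: ip_basis ip_commute[of n _ f])

section \<open>Orthonormal families and Bessel's inequality\<close>

lemma ip_orthonormal_sum:
  assumes "orthonormal n m u" "j < m"
  shows "ip n (\<lambda>k. \<Sum>i<m. c i * u i k) (u j) = c j"
proof -
  have "ip n (\<lambda>k. \<Sum>i<m. c i * u i k) (u j) = (\<Sum>i<m. c i * of_bool (i = j))"
    using assms by (simp add: ip_sum_left ip_scale_left orthonormal_def)
  then show ?thesis
    using assms(2) by (simp add: of_bool_def if_distrib cong: if_cong)
qed

text \<open>\<open>r f\<close> is \<open>f\<close> minus its orthogonal projection onto the span of
  the \<open>u i\<close>. Pairing \<open>r f\<close> with itself leaves only its pairing with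
  \<open>f\<close>, which gives Pythagoras' theorem.\<close>

lemma bessel_residual:
  assumes "orthonormal n m u"
  defines "r \<equiv> \<lambda>f k. f k - (\<Sum>i<m. ip n f (u i) * u i k)"
  shows "j < m \<Longrightarrow> ip n (r f) (u j) = 0"
    and "ip n (r f) (r f) = ip n f f - (\<Sum>i<m. (ip n f (u i))\<^sup>2)"
proof -
  show orth: "ip n (r f) (u j) = 0" if "j < m" for j
    by (simp add: r_def ip_diff_left ip_orthonormal_sum[OF assms(1) that])
  have "ip n (r f) (r f) = ip n (r f) f - (\<Sum>i<m. ip n f (u i) * ip n (r f) (u i))"
    by (subst (2) r_def) (simp add: ip_diff_right ip_sum_right ip_scale_right)
  also have "\<dots> = ip n (r f) f"
    by (simp add: orth)
  also have "\<dots> = ip n f f - (\<Sum>i<m. (ip n f (u i))\<^sup>2)"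
    by (simp add: r_def ip_diff_left ip_sum_left ip_scale_left power2_eq_square ip_commute)
  finally show "ip n (r f) (r f) = ip n f f - (\<Sum>i<m. (ip n f (u i))\<^sup>2)" .
qed

text \<open>Double counting: each vector contributes 1 to the total, while the inner sum at
  \<open>k\<close> is the squared length of the projection of the \<open>k\<close>-th standard basis
  vector.\<close>

lemma sum_orthonormal_squares:
  assumes "orthonormal n m u"
  shows "(\<Sum>k<n. \<Sum>i<m. (u i k)\<^sup>2) = m"
proof -
  have "(\<Sum>k<n. \<Sum>i<m. (u i k)\<^sup>2) = (\<Sum>i<m. ip n (u i) (u i))"
    unfolding ip_def power2_eq_square by (rule sum.swap)
  then show ?thesis
    using assms by (simp add: orthonormal_def)
qed

text \<open>By Bessel's inequality the projection of each of the \<open>n\<close> standard basis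
  vectors has squared length at most 1, so their total \<open>m\<close> is at most
  \<open>n\<close>.\<close>

lemma orthonormal_le_dim:
  assumes "orthonormal n m u"
  shows "m \<le> n"
proof -
  have "(\<Sum>i<m. (u i k)\<^sup>2) \<le> 1" if "k < n" for k
    using bessel_residual(2)[OF assms, of "\<lambda>l. of_bool (l = k)"] that
      ip_self_nonneg[of n "\<lambda>l. of_bool (l = k) - (\<Sum>i<m. ip n (\<lambda>l. of_bool (l = k)) (u i) * u i l)"]
    by (simp add: ip_basis_left)
  then have "(\<Sum>k<n. \<Sum>i<m. (u i k)\<^sup>2) \<le> (\<Sum>k<n. 1)"
    by (intro sum_mono) simp
  then show ?thesis
    by (simp add: sum_orthonormal_squares[OF assms])
qed

text \<open>If every projected standard basis vector had length 1, the squared lengths would add up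
  to \<open>n\<close> instead of \<open>m\<close>. So one of these vectors has a nonzero residual,
  which is then normalized. Coordinates from \<open>n\<close> on are set to 0 to fit the compact set
  on which the Rayleigh quotient is maximized.\<close>

lemma exists_unit_orthogonal:
  assumes "orthonormal n m u" "m < n"
  obtains f where "ip n f f = 1" "\<And>i. i < m \<Longrightarrow> ip n f (u i) = 0" "\<And>k. n \<le> k \<Longrightarrow> f k = 0"
proof -
  have "\<exists>k<n. (\<Sum>i<m. (u i k)\<^sup>2) \<noteq> 1"
  proof (rule ccontr)
    assume "\<not> ?thesis"
    then have "(\<Sum>k<n. \<Sum>i<m. (u i k)\<^sup>2) = n" by simp
    with sum_orthonormal_squares[OF assms(1)] assms(2) show False by simp
  qed
  then obtain k where k: "k < n" "(\<Sum>i<m. (u i k)\<^sup>2) \<noteq> 1" by blast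
  define e :: "nat \<Rightarrow> real" where "e = (\<lambda>l. of_bool (l = k))"
  define g where "g = (\<lambda>l. e l - (\<Sum>i<m. ip n e (u i) * u i l))"
  have orth: "ip n g (u i) = 0" if "i < m" for i
    using bessel_residual(1)[OF assms(1) that, of e] by (simp add: g_def)
  have "ip n g g \<noteq> 0"
    using bessel_residual(2)[OF assms(1), of e] k
    by (simp add: g_def e_def ip_basis_left)
  then have pos: "ip n g g > 0"
    using ip_self_nonneg[of n g] by simp
  define f where "f = (\<lambda>l. if l < n then 1 / sqrt (ip n g g) * g l else 0)"
  have f: "ip n f h = ip n g h / sqrt (ip n g g)" for h
    using ip_scale_left[of n "1 / sqrt (ip n g g)" g h]
    by (simp add: f_def cong: ip_cong)
  show ?thesis
  proof
    show "ip n f f = 1"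
      using pos by (simp add: f ip_commute[of n g f])
    show "ip n f (u i) = 0" if "i < m" for i
      using orth[OF that] by (simp add: f)
    show "f k = 0" if "n \<le> k" for k
      using that by (simp add: f_def)
  qed
qed

section \<open>Eigenvectors from maximizing the Rayleigh quotient\<close>

text \<open>Tychonoff's theorem: the set is closed in the product topology and lies in a product of
  compact sets. As \<open>ip n\<close> does not see the coordinates from \<open>n\<close> on, they
  have to be fixed at 0.\<close>

lemma compact_unit_sphere:
  "compact {f. ip n f f = 1 \<and> (\<forall>i<m. ip n f (u i) = 0) \<and> (\<forall>k\<ge>n. f k = 0)}"
proof -
  define K :: "(nat \<Rightarrow> real) set" where
    "K = PiE UNIV (\<lambda>k. if k < n then {-1..1} else {0})"
  have cont: "continuous_on UNIV (\<lambda>f. ip n f (g f))" if "\<And>k. continuous_on UNIV (\<lambda>f. g f k)" for g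
    unfolding ip_def by (intro continuous_intros that continuous_on_product_coordinates)
  have "compactin (product_topology (\<lambda>i. euclidean) UNIV) K"
    by (simp add: K_def compactin_PiE)
  then have "compact K"
    by (simp add: euclidean_product_topology)
  moreover have "closed {f. ip n f f = 1 \<and> (\<forall>i<m. ip n f (u i) = 0) \<and> (\<forall>k\<ge>n. f k = 0)}"
    by (intro closed_Collect_conj closed_Collect_all closed_Collect_imp closed_Collect_eq cont
        open_Collect_const) (auto intro!: continuous_on_const continuous_on_product_coordinates)
  moreover have "{f. ip n f f = 1 \<and> (\<forall>i<m. ip n f (u i) = 0) \<and> (\<forall>k\<ge>n. f k = 0)} \<subseteq> K"
  proof
    fix f assume f: "f \<in> {f. ip n f f = 1 \<and> (\<forall>i<m. ip n f (u i) = 0) \<and> (\<forall>k\<ge>n. f k = 0)}"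
    have "\<bar>f k\<bar> \<le> 1" if "k < n" for k
    proof -
      have "(f k)\<^sup>2 \<le> ip n f f"
        unfolding ip_def power2_eq_square
        using member_le_sum[of k "{..<n}" "\<lambda>k. f k * f k"] that by simp
      with f show ?thesis
        by (simp add: abs_square_le_1)
    qed
    with f show "f \<in> K"
      by (auto simp: K_def abs_le_iff)
  qed
  ultimately show ?thesis
    by (metis (no_types, lifting) compact_Int_closed inf.absorb_iff2)
qed

text \<open>
  The new eigenvector maximizes the Rayleigh quotient on the unit sphere of the
  orthogonal complement of the given ones.
\<close>

lemma exists_orthogonal_eigenvector:
  assumes sym: "\<And>i j. i < n \<Longrightarrow> j < n \<Longrightarrow> a i j = a j i"
    and sys: "eigen_system n m a u d" and m: "m < n"
  obtains v \<mu> where "ip n v v = 1" "\<And>i. i < m \<Longrightarrow> ip n v (u i) = 0"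
    "\<And>k. k < n \<Longrightarrow> matvec n a v k = \<mu> * v k"
proof -
  from sys have orth: "orthonormal n m u"
    and eig: "\<And>i k. i < m \<Longrightarrow> k < n \<Longrightarrow> matvec n a (u i) k = d i * u i k"
    by (auto simp: eigen_system_def)
  define T where "T = {f. ip n f f = 1 \<and> (\<forall>i<m. ip n f (u i) = 0) \<and> (\<forall>k\<ge>n. f k = 0)}"
  define q where "q f = ip n f (matvec n a f)" for f
  have "compact T"
    unfolding T_def by (rule compact_unit_sphere)
  moreover have "T \<noteq> {}"
    by (rule exists_unit_orthogonal[OF orth m]) (auto simp: T_def)
  moreover have "continuous_on T q"
  proof (rule continuous_on_subset)
    show "continuous_on UNIV q"
      unfolding q_def ip_def matvec_def by (intro continuous_intros continuous_on_product_coordinates)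
  qed simp
  ultimately obtain v where v: "v \<in> T" and max: "\<And>f. f \<in> T \<Longrightarrow> q f \<le> q v"
    using continuous_attains_sup by metis
  define \<mu> where "\<mu> = q v"
  have v1: "ip n v v = 1" and vu: "\<And>i. i < m \<Longrightarrow> ip n v (u i) = 0"
    using v by (auto simp: T_def)
  \<comment> \<open>Maximality on the unit sphere passes by scaling to every vector orthogonal to
    the \<open>u i\<close>.\<close>
  have bound: "q f \<le> \<mu> * ip n f f" if "\<And>i. i < m \<Longrightarrow> ip n f (u i) = 0" for f
  proof (cases "ip n f f = 0")
    case True
    then have "q f = ip n (\<lambda>_. 0) (matvec n a f)"
      unfolding q_def by (intro ip_cong) (auto simp: ip_self_eq_0)
    then show ?thesis
      using True by (simp add: ip_def[of n "\<lambda>_. 0"])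
  next
    case False
    then have pos: "ip n f f > 0"
      using ip_self_nonneg[of n f] by simp
    define c where "c = 1 / sqrt (ip n f f)"
    have c2: "c * c * ip n f f = 1"
      using pos by (simp add: c_def field_simps)
    define g where "g = (\<lambda>l. if l < n then c * f l else 0)"
    have g: "ip n g h = c * ip n f h" "ip n h g = c * ip n h f" for h
      using ip_scale_left[of n c f h] ip_scale_right[of n h c f] by (simp_all add: g_def cong: ip_cong)
    have "matvec n a g = (\<lambda>k. c * matvec n a f k)"
      by (simp add: matvec_def g_def sum_distrib_left algebra_simps fun_eq_iff)
    then have qg: "q g = c * c * q f"
      by (simp add: q_def g ip_scale_right)
    have "g \<in> T"
      using c2 that by (simp add: T_def g) (simp add: g_def)
    from max[OF this] have "c * c * q f * ip n f f \<le> \<mu> * ip n f f"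
      using pos by (simp add: qg \<mu>_def)
    moreover have "c * c * q f * ip n f f = q f * (c * c * ip n f f)"
      by simp
    ultimately show ?thesis
      by (simp only: c2 mult_1_right)
  qed
  \<comment> \<open>\<open>h\<close> is the defect in the eigenvector equation. By symmetry of
    \<open>a\<close> it is again orthogonal to the \<open>u i\<close>, so every
    \<open>v + t h\<close> is admissible in \<open>bound\<close>.\<close>
  define h where "h = (\<lambda>k. matvec n a v k - \<mu> * v k)"
  have hu: "ip n h (u i) = 0" if "i < m" for i
  proof -
    have "ip n (matvec n a v) (u i) = ip n v (\<lambda>k. d i * u i k)"
      using eig[OF that] by (subst ip_matvec[OF sym, symmetric]) (auto intro: ip_cong)
    then show ?thesis
      using vu[OF that] by (simp add: h_def ip_diff_left ip_scale_left ip_scale_right)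
  qed
  define c where "c = ip n h h"
  define K where "K = \<mu> * ip n h h - q h"
  have hc: "ip n h (matvec n a v) - \<mu> * ip n h v = c"
    unfolding c_def by (subst (4) h_def) (simp add: ip_diff_right ip_scale_right)
  \<comment> \<open>Applying \<open>bound\<close> to \<open>v + t h\<close> cancels the constant
    terms; \<open>2 * t * c\<close> is the first-order part and \<open>t * t * K\<close> the
    second-order part.\<close>
  have quad: "2 * t * c \<le> t * t * K" for t
  proof -
    define f where "f = (\<lambda>k. v k + t * h k)"
    have "matvec n a f = (\<lambda>k. matvec n a v k + t * matvec n a h k)"
      unfolding f_def by (simp add: matvec_linear fun_eq_iff)
    moreover have "ip n v (matvec n a h) = ip n h (matvec n a v)"
      using ip_matvec[of n a v h, OF sym] by (simp add: ip_commute[of n h])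
    ultimately have "q f = \<mu> + 2 * t * ip n h (matvec n a v) + t * t * q h"
      unfolding q_def[of f] by (simp add: f_def ip_add_left ip_add_right ip_scale_left ip_scale_right
          algebra_simps \<mu>_def q_def)
    moreover have "ip n f f = 1 + 2 * t * ip n h v + t * t * ip n h h"
      by (simp add: f_def ip_add_left ip_add_right ip_scale_left ip_scale_right v1
          ip_commute[of n v h] algebra_simps)
    moreover have "q f \<le> \<mu> * ip n f f"
      using hu vu by (intro bound) (simp add: f_def ip_add_left ip_scale_left)
    ultimately show ?thesis
      by (simp add: hc[symmetric] K_def algebra_simps)
  qed
  have "c = 0"
  proof (rule ccontr)
    assume "c \<noteq> 0"
    then have c: "c > 0"
      using ip_self_nonneg[of n h] by (simp add: c_def)
    \<comment> \<open>So small that the second-order part cannot compensate the first-order one: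
      \<open>t * (\<bar>K\<bar> + 1) = c\<close> turns the inequality into
      \<open>2 * c \<le> c\<close>.\<close>
    define t where "t = c / (\<bar>K\<bar> + 1)"
    have t: "t > 0"
      using c by (simp add: t_def)
    have "t * (2 * c) \<le> t * (t * K)"
      using quad[of t] by (simp add: mult_ac)
    then have "2 * c \<le> t * K"
      using t by simp
    also have "\<dots> \<le> t * (\<bar>K\<bar> + 1)"
      using t by (intro mult_left_mono) auto
    also have "\<dots> = c"
      unfolding t_def by simp
    finally show False
      using c by simp
  qed
  then have "matvec n a v k = \<mu> * v k" if "k < n" for k
    using that by (simp add: c_def ip_self_eq_0 h_def)
  with v1 vu that show ?thesis
    by blast
qed

text \<open>One eigenvector is added at a time, so the induction runs from \<open>n\<close> down to
  \<open>m\<close>. That the given vectors are kept allows the component vectors to be part of the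
  eigenbasis; \<open>m = 0\<close> is the usual spectral theorem.\<close>

lemma eigen_system_extend:
  assumes sym: "\<And>i j. i < n \<Longrightarrow> j < n \<Longrightarrow> a i j = a j i"
    and sys: "eigen_system n m a u d"
  obtains q e where "eigen_system n n a q e" "\<And>i. i < m \<Longrightarrow> q i = u i" "\<And>i. i < m \<Longrightarrow> e i = d i"
proof -
  have "m \<le> n"
    using sys orthonormal_le_dim by (auto simp: eigen_system_def)
  then have "\<exists>q e. eigen_system n n a q e \<and> (\<forall>i<m. q i = u i \<and> e i = d i)"
    using sys
  proof (induction m arbitrary: u d rule: inc_induct)
    case base
    then show ?case by blast
  next
    case (step m)
    obtain v \<mu> where v: "ip n v v = 1" "\<And>i. i < m \<Longrightarrow> ip n v (u i) = 0"
      "\<And>k. k < n \<Longrightarrow> matvec n a v k = \<mu> * v k"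
      using exists_orthogonal_eigenvector[OF sym step.prems step.hyps(2)] by blast
    have "eigen_system n (Suc m) a (u(m := v)) (d(m := \<mu>))"
      using step.prems v
      by (auto simp: eigen_system_def orthonormal_def less_Suc_eq ip_commute)
    from step.IH[OF this] obtain q e where
      "eigen_system n n a q e" "\<forall>i<Suc m. q i = (u(m := v)) i \<and> e i = (d(m := \<mu>)) i"
      by blast
    then show ?case
      by (metis fun_upd_apply less_SucI less_irrefl)
  qed
  with that show ?thesis by blast
qed

section \<open>Characteristic polynomial and singular values\<close>

text \<open>The \<open>q i\<close> are the columns of \<open>Q\<close>. A left inverse of a square
  matrix is also a right inverse, so the rows of \<open>Q\<close> are orthonormal too.\<close>

lemma orthonormal_dual:
  assumes "orthonormal n n q"
  defines "Q \<equiv> mat n n (\<lambda>(k, i). q i k)"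
  shows "transpose_mat Q * Q = 1\<^sub>m n" "Q * transpose_mat Q = 1\<^sub>m n"
    and "k < n \<Longrightarrow> l < n \<Longrightarrow> (\<Sum>i<n. q i k * q i l) = of_bool (k = l)"
proof -
  show 1: "transpose_mat Q * Q = 1\<^sub>m n"
    using assms(1) by (intro eq_matI)
      (auto simp: Q_def scalar_prod_def orthonormal_def ip_def atLeast0LessThan)
  show 2: "Q * transpose_mat Q = 1\<^sub>m n"
    by (rule mat_mult_left_right_inverse[OF _ _ 1]) (auto simp: Q_def)
  show "(\<Sum>i<n. q i k * q i l) = of_bool (k = l)" if "k < n" "l < n"
    using arg_cong[OF 2, of "\<lambda>B. B $$ (k, l)"] that
    by (simp add: Q_def scalar_prod_def atLeast0LessThan)
qed

text \<open>With the sum over \<open>i\<close> moved innermost, orthonormality of the rows collapses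
  the double sum over \<open>k\<close> and \<open>l\<close> to its diagonal.\<close>

lemma parseval:
  assumes "orthonormal n n q"
  shows "ip n f g = (\<Sum>i<n. ip n (q i) f * ip n (q i) g)"
proof -
  have "(\<Sum>i<n. ip n (q i) f * ip n (q i) g)
      = (\<Sum>i<n. \<Sum>k<n. \<Sum>l<n. f k * g l * (q i k * q i l))"
    by (simp add: ip_def sum_product mult_ac)
  also have "\<dots> = (\<Sum>k<n. \<Sum>i<n. \<Sum>l<n. f k * g l * (q i k * q i l))"
    by (rule sum.swap)
  also have "\<dots> = (\<Sum>k<n. \<Sum>l<n. \<Sum>i<n. f k * g l * (q i k * q i l))"
    by (intro sum.cong refl sum.swap)
  also have "\<dots> = (\<Sum>k<n. \<Sum>l<n. f k * g l * of_bool (k = l))"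
    by (simp add: orthonormal_dual(3)[OF assms] flip: sum_distrib_left)
  also have "\<dots> = ip n f g"
    by (simp add: ip_def of_bool_def if_distrib cong: if_cong)
  finally show ?thesis ..
qed

text \<open>The orthogonal matrix \<open>Q\<close> of eigenvectors makes \<open>A\<close> similar to
  the diagonal matrix of the \<open>d i\<close>, and similar matrices have the same characteristic
  polynomial.\<close>

lemma char_poly_eigen_system:
  assumes A: "A \<in> carrier_mat n n" and sys: "eigen_system n n (\<lambda>i j. A $$ (i, j)) q d"
  shows "char_poly A = (\<Prod>x\<leftarrow>map d [0..<n]. [:- x, 1:])"
proof -
  from sys have orth: "orthonormal n n q"
    and eig: "\<And>i k. i < n \<Longrightarrow> k < n \<Longrightarrow> matvec n (\<lambda>i j. A $$ (i, j)) (q i) k = d i * q i k"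
    by (auto simp: eigen_system_def)
  define Q where "Q = mat n n (\<lambda>(k, i). q i k)"
  note inv = orthonormal_dual(1,2)[OF orth, folded Q_def]
  have Q: "Q \<in> carrier_mat n n" "transpose_mat Q \<in> carrier_mat n n"
    by (auto simp: Q_def)
  have D: "mat_diag n d \<in> carrier_mat n n" by simp
  have "A * Q = Q * mat_diag n d"
    using A eig by (subst mat_diag_mult_right[OF Q(1)], intro eq_matI)
      (auto simp: Q_def scalar_prod_def matvec_def atLeast0LessThan mult.commute)
  then have "Q * mat_diag n d * transpose_mat Q = A * (Q * transpose_mat Q)"
    using A Q by (simp flip: assoc_mult_mat[OF A Q])
  then have "A = Q * mat_diag n d * transpose_mat Q"
    using A by (simp add: inv)
  then have "similar_mat_wit A (mat_diag n d) Q (transpose_mat Q)"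
    using inv A Q D by (intro similar_mat_witI)
  then have "char_poly A = char_poly (mat_diag n d)"
    by (intro char_poly_similar) (auto simp: similar_mat_def)
  also have "\<dots> = (\<Prod>x\<leftarrow>diag_mat (mat_diag n d). [:- x, 1:])"
    by (rule char_poly_upper_triangular[OF D]) (auto simp: mat_diag_def)
  also have "diag_mat (mat_diag n d) = map d [0..<n]"
    by (auto simp: diag_mat_def mat_diag_def)
  finally show ?thesis .
qed

text \<open>The characteristic polynomial splits into the factors belonging to the
  \<open>d i\<close>, so its roots with multiplicity are exactly these numbers.\<close>

lemma eigenvalue_list_eigen_system:
  assumes "A \<in> carrier_mat n n" "eigen_system n n (\<lambda>i j. A $$ (i, j)) q d"
  shows "eigenvalue_list A = sort (map d [0..<n])"
proof -
  have nonzero: "(\<Prod>x\<leftarrow>xs. [:- x, 1:]) \<noteq> 0" for xs :: "real list"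
    by (induction xs) (simp_all del: mult_pCons_left)
  have "proots (\<Prod>x\<leftarrow>xs. [:- x, 1:]) = mset xs" for xs :: "real list"
    by (induction xs) (simp_all add: proots_mult[OF _ nonzero] del: mult_pCons_left)
  then show ?thesis
    by (simp only: eigenvalue_list_def char_poly_eigen_system[OF assms] sorted_list_of_multiset_mset)
qed

lemma eigenvalue_eigen_system:
  assumes A: "A \<in> carrier_mat n n" and sys: "eigen_system n m (\<lambda>i j. A $$ (i, j)) q d" and "i < m"
  shows "eigenvalue A (d i)"
proof -
  have "A *\<^sub>v vec n (q i) = d i \<cdot>\<^sub>v vec n (q i)"
    using assms by (intro eq_vecI) (auto simp: eigen_system_def matvec_def scalar_prod_def atLeast0LessThan)
  moreover have "vec n (q i) \<noteq> 0\<^sub>v n"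
  proof
    assume "vec n (q i) = 0\<^sub>v n"
    then have "q i k = 0" if "k < n" for k
      using that by (metis index_vec index_zero_vec(1))
    then have "ip n (q i) (q i) = 0"
      by (simp add: ip_self_eq_0)
    with sys \<open>i < m\<close> show False
      by (simp add: eigen_system_def orthonormal_def)
  qed
  ultimately show ?thesis
    using A unfolding eigenvalue_def eigenvector_def by (intro exI[of _ "vec n (q i)"]) auto
qed

text \<open>As \<open>c\<close> is an upper bound, \<open>m\<close> copies of it may stand at the
  end of the sorted list, even when \<open>c\<close> occurs among the other entries as well.\<close>

lemma sort_split_top:
  fixes d :: "nat \<Rightarrow> real"
  assumes "m \<le> n" "\<And>i. i < m \<Longrightarrow> d i = c" "\<And>i. i < n \<Longrightarrow> d i \<le> c"
  shows "sort (map d [0..<n]) = sort (map d [m..<n]) @ replicate m c"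
proof (rule properties_for_sort)
  have "map d [0..<m] = replicate m c"
    using assms(2) by (intro nth_equalityI) auto
  then have "map d [0..<n] = replicate m c @ map d [m..<n]"
    using upt_add_eq_append[of 0 m "n - m"] assms(1) by simp
  then show "mset (sort (map d [m..<n]) @ replicate m c) = mset (map d [0..<n])"
    by simp
  show "sorted (sort (map d [m..<n]) @ replicate m c)"
    using assms(3) by (auto simp: sorted_append sorted_replicate)
qed

text \<open>
  The singular values come from \<open>W\<^sup>T W\<close> and so bound the norm of \<open>W y\<close>; Cauchy-Schwarz
  transfers the bound to \<open>W\<^sup>T x\<close>, since the rows of \<open>X\<close> are multiplied by \<open>W\<close> from the right.
\<close>

lemma max_singular_value_bound:
  assumes W: "W \<in> carrier_mat n n" and n: "n > 0"
  shows "max_singular_value W \<ge> 0"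
    and "(\<Sum>j<n. (\<Sum>k<n. x k * W $$ (k, j))\<^sup>2) \<le> (max_singular_value W)\<^sup>2 * (\<Sum>k<n. (x k)\<^sup>2)"
proof -
  define B where "B = transpose_mat W * W"
  define w where "w i j = W $$ (i, j)" for i j
  define b where "b i j = B $$ (i, j)" for i j
  define s where "s = max_singular_value W"
  have B: "B \<in> carrier_mat n n"
    using W by (simp add: B_def)
  have b: "b i j = (\<Sum>k<n. w k i * w k j)" if "i < n" "j < n" for i j
    using W that by (simp add: b_def B_def w_def scalar_prod_def atLeast0LessThan)
  have sym: "b i j = b j i" if "i < n" "j < n" for i j
    using that by (simp add: b mult.commute)
  \<comment> \<open>The spectral theorem for \<open>B\<close>, obtained by extending the empty
    family.\<close>
  have "\<exists>q d. eigen_system n n b q d"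
    by (rule eigen_system_extend[of n b 0 undefined undefined])
      (blast intro: sym | simp add: eigen_system_def orthonormal_def)+
  then obtain q d where sys: "eigen_system n n b q d"
    by blast
  then have orth: "orthonormal n n q"
    and eig: "\<And>i k. i < n \<Longrightarrow> k < n \<Longrightarrow> matvec n b (q i) k = d i * q i k"
    by (auto simp: eigen_system_def)
  \<comment> \<open>The quadratic form of \<open>B\<close> is the squared length of
    \<open>W f\<close>.\<close>
  have quad: "ip n f (matvec n b f) = ip n (matvec n w f) (matvec n w f)" for f
  proof -
    have "ip n f (matvec n b f) = (\<Sum>i<n. \<Sum>j<n. \<Sum>k<n. w k i * f i * (w k j * f j))"
      by (simp add: ip_def matvec_def b sum_distrib_left sum_distrib_right mult_ac)
    also have "\<dots> = (\<Sum>i<n. \<Sum>k<n. \<Sum>j<n. w k i * f i * (w k j * f j))"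
      by (intro sum.cong refl sum.swap)
    also have "\<dots> = (\<Sum>k<n. \<Sum>i<n. \<Sum>j<n. w k i * f i * (w k j * f j))"
      by (rule sum.swap)
    also have "\<dots> = ip n (matvec n w f) (matvec n w f)"
      by (simp add: ip_def matvec_def sum_product)
    finally show ?thesis .
  qed
  \<comment> \<open>\<open>Max\<close> bounds the elements of its set only if the set is
    finite.\<close>
  have fin: "finite (singular_values W)"
  proof -
    have "char_poly B \<noteq> 0"
      using degree_monic_char_poly[OF B] by auto
    then have "finite {k. eigenvalue B k}"
      using poly_roots_finite by (simp add: eigenvalue_root_char_poly[OF B])
    then show ?thesis
      by (simp add: singular_values_def B_def)
  qed
  have d: "0 \<le> d i \<and> sqrt (d i) \<le> s" if "i < n" for i
  proof
    have "ip n (q i) (matvec n b (q i)) = ip n (q i) (\<lambda>k. d i * q i k)"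
      using eig[OF that] by (intro ip_cong) auto
    also have "\<dots> = d i"
      using orth that by (simp add: ip_scale_right orthonormal_def)
    finally show "0 \<le> d i"
      using quad[of "q i"] ip_self_nonneg[of n "matvec n w (q i)"] by simp
    have "eigenvalue B (d i)"
      using eigenvalue_eigen_system[OF B] sys that unfolding b_def by blast
    then have "sqrt (d i) \<in> singular_values W"
      by (auto simp: singular_values_def B_def)
    with fin show "sqrt (d i) \<le> s"
      by (simp add: s_def max_singular_value_def)
  qed
  from d[OF n] show s: "0 \<le> max_singular_value W"
    using real_sqrt_ge_zero unfolding s_def by (meson order_trans)
  have ds: "d i \<le> s\<^sup>2" if "i < n" for i
    using d[OF that] by (metis real_sqrt_le_iff real_sqrt_abs abs_of_nonneg order_trans real_sqrt_ge_zero)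
  \<comment> \<open>In the eigenbasis of \<open>B\<close> the squared length of \<open>W f\<close>
    is a sum of squared coordinates weighted by the \<open>d i\<close>, each at most
    \<open>s\<^sup>2\<close>.\<close>
  have bound: "ip n (matvec n w f) (matvec n w f) \<le> s\<^sup>2 * ip n f f" for f
  proof -
    have "ip n (q i) (matvec n b f) = d i * ip n (q i) f" if "i < n" for i
    proof -
      have "ip n (q i) (matvec n b f) = ip n (matvec n b (q i)) f"
        by (rule ip_matvec[OF sym])
      also have "\<dots> = ip n (\<lambda>k. d i * q i k) f"
        using eig[OF that] by (intro ip_cong) auto
      finally show ?thesis
        by (simp add: ip_scale_left)
    qed
    then have "ip n (matvec n w f) (matvec n w f) = (\<Sum>i<n. d i * (ip n (q i) f)\<^sup>2)"
      unfolding quad[symmetric] parseval[OF orth, of f "matvec n b f"]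
      by (intro sum.cong) (auto simp: power2_eq_square)
    also have "\<dots> \<le> (\<Sum>i<n. s\<^sup>2 * (ip n (q i) f)\<^sup>2)"
      using ds by (intro sum_mono mult_right_mono) auto
    also have "\<dots> = s\<^sup>2 * ip n f f"
      by (simp add: parseval[OF orth, of f f] sum_distrib_left power2_eq_square)
    finally show ?thesis .
  qed
  \<comment> \<open>\<open>y\<close> is the transpose of \<open>W\<close> applied to
    \<open>x\<close>.\<close>
  define y where "y j = (\<Sum>k<n. x k * w k j)" for j
  have "ip n y y = ip n x (matvec n w y)"
  proof -
    have "ip n y y = (\<Sum>j<n. \<Sum>k<n. x k * w k j * y j)"
      by (subst (1) ip_def) (subst (1) y_def, simp add: sum_distrib_right)
    also have "\<dots> = (\<Sum>k<n. \<Sum>j<n. x k * w k j * y j)"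
      by (rule sum.swap)
    finally show ?thesis
      by (simp add: ip_def matvec_def sum_distrib_left mult.assoc)
  qed
  \<comment> \<open>Cauchy-Schwarz and \<open>bound\<close> for \<open>y\<close> give an inequality
    with a factor \<open>ip n y y\<close> on both sides; it is cancelled unless it is 0, when the
    claim is immediate.\<close>
  then have "(ip n y y)\<^sup>2 \<le> ip n x x * ip n (matvec n w y) (matvec n w y)"
    using Convex.Cauchy_Schwarz_ineq_sum[of x "matvec n w y" "{..<n}"] by (simp add: ip_def power2_eq_square)
  also have "\<dots> \<le> ip n x x * (s\<^sup>2 * ip n y y)"
    by (intro mult_left_mono bound ip_self_nonneg)
  finally have "ip n y y * ip n y y \<le> (s\<^sup>2 * ip n x x) * ip n y y"
    by (simp add: power2_eq_square mult_ac)
  then have "ip n y y \<le> s\<^sup>2 * ip n x x"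
    using ip_self_nonneg[of n y] ip_self_nonneg[of n x]
    by (cases "ip n y y = 0") auto
  then show "(\<Sum>j<n. (\<Sum>k<n. x k * W $$ (k, j))\<^sup>2) \<le> (max_singular_value W)\<^sup>2 * (\<Sum>k<n. (x k)\<^sup>2)"
    by (simp add: ip_def y_def w_def s_def power2_eq_square)
qed

section \<open>Distance to a space of matrices with columns in a given span\<close>

text \<open>The matrix is a sum of tensor products of \<open>u i\<close> with the rows
  \<open>b i\<close>, so \<open>b i\<close> takes the role of \<open>w_m\<close>.\<close>

definition span_mats :: "nat \<Rightarrow> nat \<Rightarrow> nat \<Rightarrow> (nat \<Rightarrow> nat \<Rightarrow> real) \<Rightarrow> real mat set" where
  "span_mats n C m u =
     {Y \<in> carrier_mat n C. \<exists>b. \<forall>k<n. \<forall>c<C. Y $$ (k, c) = (\<Sum>i<m. u i k * b i c)}"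

lemma span_mats_cong:
  assumes "\<And>i. i < m \<Longrightarrow> u i = v i"
  shows "span_mats n C m u = span_mats n C m v"
  using assms by (simp add: span_mats_def)

lemma span_mats_nonempty: "span_mats n C m u \<noteq> {}"
proof -
  have "0\<^sub>m n C \<in> span_mats n C m u"
    unfolding span_mats_def by (auto intro!: exI[of _ "\<lambda>_ _. 0"])
  then show ?thesis by blast
qed

section \<open>Comparison of Frobenius norms\<close>

lemma frobenius_norm_square:
  "A \<in> carrier_mat n C \<Longrightarrow> (frobenius_norm A)\<^sup>2 = (\<Sum>i<n. \<Sum>j<C. (A $$ (i, j))\<^sup>2)"
  by (auto simp: frobenius_norm_def intro!: sum_nonneg)

lemma frobenius_norm_nonneg: "0 \<le> frobenius_norm A"
  by (auto simp: frobenius_norm_def intro!: sum_nonneg)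

text \<open>Suited to ReLU and to multiplication from the right, which act on each row separately.
  The version for columns serves multiplication from the left.\<close>

lemma frobenius_norm_le_rows:
  assumes A: "A \<in> carrier_mat n C" and B: "B \<in> carrier_mat n C" and "0 \<le> k"
    and rows: "\<And>i. i < n \<Longrightarrow> (\<Sum>j<C. (A $$ (i, j))\<^sup>2) \<le> k\<^sup>2 * (\<Sum>j<C. (B $$ (i, j))\<^sup>2)"
  shows "frobenius_norm A \<le> k * frobenius_norm B"
proof (rule power2_le_imp_le)
  have "(frobenius_norm A)\<^sup>2 \<le> (\<Sum>i<n. k\<^sup>2 * (\<Sum>j<C. (B $$ (i, j))\<^sup>2))"
    unfolding frobenius_norm_square[OF A] using rows by (intro sum_mono) auto
  then show "(frobenius_norm A)\<^sup>2 \<le> (k * frobenius_norm B)\<^sup>2"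
    by (simp add: power_mult_distrib frobenius_norm_square[OF B] sum_distrib_left)
qed (use \<open>0 \<le> k\<close> frobenius_norm_nonneg in auto)

lemma frobenius_norm_transpose: "frobenius_norm (transpose_mat A) = frobenius_norm A"
  unfolding frobenius_norm_def by (subst sum.swap) simp

lemma frobenius_norm_le_cols:
  assumes A: "A \<in> carrier_mat n C" and B: "B \<in> carrier_mat n C" and "0 \<le> k"
    and cols: "\<And>j. j < C \<Longrightarrow> (\<Sum>i<n. (A $$ (i, j))\<^sup>2) \<le> k\<^sup>2 * (\<Sum>i<n. (B $$ (i, j))\<^sup>2)"
  shows "frobenius_norm A \<le> k * frobenius_norm B"
  using frobenius_norm_le_rows[of "transpose_mat A" C n "transpose_mat B" k] assms
  by (simp add: frobenius_norm_transpose)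

section \<open>Distance as an infimum\<close>

lemma dist_to_nonneg:
  assumes "S \<noteq> {}"
  shows "0 \<le> dist_to S X"
  unfolding dist_to_def using assms frobenius_norm_nonneg by (intro cInf_greatest) auto

lemma dist_to_le: "Y \<in> S \<Longrightarrow> dist_to S X \<le> frobenius_norm (X - Y)"
  unfolding dist_to_def using frobenius_norm_nonneg by (intro cInf_lower bdd_belowI[of _ 0]) auto

text \<open>Every approximant of \<open>X\<close> is turned into one of \<open>X'\<close>, without
  reference to a minimizer. Moving the factor into the infimum means dividing by \<open>k\<close>,
  hence the separate case \<open>k = 0\<close>.\<close>

lemma dist_to_le_scale:
  assumes "S \<noteq> {}" "0 \<le> k"
    and approx: "\<And>Y. Y \<in> S \<Longrightarrow> \<exists>Y'\<in>S. frobenius_norm (X' - Y') \<le> k * frobenius_norm (X - Y)"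
  shows "dist_to S X' \<le> k * dist_to S X"
proof -
  have le: "dist_to S X' \<le> k * frobenius_norm (X - Y)" if "Y \<in> S" for Y
    using approx[OF that] dist_to_le order_trans by blast
  show ?thesis
  proof (cases "k = 0")
    case True
    with assms(1) le show ?thesis by auto
  next
    case False
    with assms(2) have k: "k > 0" by simp
    have "dist_to S X' / k \<le> dist_to S X"
      unfolding dist_to_def[of S X] using assms(1) le k
      by (intro cInf_greatest) (auto simp: divide_le_eq mult.commute)
    with k show ?thesis
      by (simp add: divide_le_eq mult.commute)
  qed
qed

section \<open>Effect of the three factors of a layer on the distance\<close>

text \<open>By disjointness of the supports, each row of a member of the space involves at most one
  \<open>u i\<close>, whose entry is nonnegative there. ReLU therefore acts on the coefficients
  alone, and \<open>relu Y\<close> is again in the space.\<close>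

lemma dist_to_span_relu:
  assumes nonneg: "\<And>i k. i < m \<Longrightarrow> k < n \<Longrightarrow> 0 \<le> u i k"
    and disj: "\<And>i j k. i < m \<Longrightarrow> j < m \<Longrightarrow> k < n \<Longrightarrow> u i k \<noteq> 0 \<Longrightarrow> u j k \<noteq> 0 \<Longrightarrow> i = j"
    and X: "X \<in> carrier_mat n C"
  shows "dist_to (span_mats n C m u) (relu X) \<le> dist_to (span_mats n C m u) X"
proof -
  have "dist_to (span_mats n C m u) (relu X) \<le> 1 * dist_to (span_mats n C m u) X"
  proof (rule dist_to_le_scale[OF span_mats_nonempty])
    fix Y assume "Y \<in> span_mats n C m u"
    then obtain b where Y: "Y \<in> carrier_mat n C"
      and b: "\<And>k c. k < n \<Longrightarrow> c < C \<Longrightarrow> Y $$ (k, c) = (\<Sum>i<m. u i k * b i c)"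
      by (auto simp: span_mats_def)
    have "max (\<Sum>i<m. u i k * b i c) 0 = (\<Sum>i<m. u i k * max (b i c) 0)" if k: "k < n" for k c
    proof (cases "\<exists>i<m. u i k \<noteq> 0")
      case True
      then obtain i where i: "i < m" "u i k \<noteq> 0" by blast
      have single: "(\<Sum>j<m. u j k * g j) = u i k * g i" for g
      proof -
        have "(\<Sum>j<m. u j k * g j) = (\<Sum>j<m. if j = i then u i k * g i else 0)"
          using disj[OF _ i(1) k _ i(2)] by (intro sum.cong) auto
        with i(1) show ?thesis by simp
      qed
      show ?thesis
        unfolding single using nonneg[OF i(1) k] by (simp add: max_mult_distrib_left)
    qed simp
    then have "relu Y \<in> span_mats n C m u"
      using Y b unfolding span_mats_def relu_def
      by (auto intro!: exI[of _ "\<lambda>i c. max (b i c) 0"])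
    moreover have "frobenius_norm (relu X - relu Y) \<le> 1 * frobenius_norm (X - Y)"
    proof (rule frobenius_norm_le_rows)
      have lip: "(max x 0 - max y 0)\<^sup>2 \<le> (x - y)\<^sup>2" for x y :: real
        unfolding abs_le_square_iff[symmetric] by (simp add: max_def)
      show "(\<Sum>j<C. ((relu X - relu Y) $$ (i, j))\<^sup>2) \<le> 1\<^sup>2 * (\<Sum>j<C. ((X - Y) $$ (i, j))\<^sup>2)"
        if "i < n" for i
        using X Y that by (auto simp: relu_def intro!: sum_mono lip)
    qed (use X Y in \<open>auto simp: relu_def\<close>)
    ultimately show "\<exists>Y'\<in>span_mats n C m u.
        frobenius_norm (relu X - Y') \<le> 1 * frobenius_norm (X - Y)"
      by blast
  qed simp
  then show ?thesis by simp
qed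

text \<open>\<open>Y * W\<close> is again in the space, with coefficient rows \<open>b i\<close>
  multiplied by \<open>W\<close>, and the singular value bound applies to each row of
  \<open>X - Y\<close>.\<close>

lemma dist_to_span_mult_right:
  assumes X: "X \<in> carrier_mat n C" and W: "W \<in> carrier_mat C C" and "C > 0"
    and s: "max_singular_value W \<le> s"
  shows "dist_to (span_mats n C m u) (X * W) \<le> s * dist_to (span_mats n C m u) X"
proof (rule dist_to_le_scale[OF span_mats_nonempty])
  note sv = max_singular_value_bound[OF W \<open>C > 0\<close>]
  show "0 \<le> s"
    using sv(1) s by simp
  fix Y assume "Y \<in> span_mats n C m u"
  then obtain b where Y: "Y \<in> carrier_mat n C"
    and b: "\<And>k c. k < n \<Longrightarrow> c < C \<Longrightarrow> Y $$ (k, c) = (\<Sum>i<m. u i k * b i c)"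
    by (auto simp: span_mats_def)
  have "(Y * W) $$ (k, c) = (\<Sum>i<m. u i k * (\<Sum>j<C. b i j * W $$ (j, c)))"
    if "k < n" "c < C" for k c
  proof -
    have "(Y * W) $$ (k, c) = (\<Sum>j<C. \<Sum>i<m. u i k * (b i j * W $$ (j, c)))"
      using Y W that
      by (simp add: scalar_prod_def atLeast0LessThan b sum_distrib_right mult.assoc)
    also have "\<dots> = (\<Sum>i<m. \<Sum>j<C. u i k * (b i j * W $$ (j, c)))"
      by (rule sum.swap)
    finally show ?thesis
      by (simp add: sum_distrib_left)
  qed
  then have "Y * W \<in> span_mats n C m u"
    using Y W unfolding span_mats_def
    by (auto intro!: exI[of _ "\<lambda>i c. \<Sum>j<C. b i j * W $$ (j, c)"] simp del: index_mult_mat(1))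
  moreover have "frobenius_norm (X * W - Y * W) \<le> s * frobenius_norm (X - Y)"
  proof (rule frobenius_norm_le_rows)
    fix i assume i: "i < n"
    have "(\<Sum>j<C. ((X * W - Y * W) $$ (i, j))\<^sup>2)
        = (\<Sum>j<C. (\<Sum>k<C. (X - Y) $$ (i, k) * W $$ (k, j))\<^sup>2)"
      using X Y W i
      by (simp add: scalar_prod_def atLeast0LessThan sum_subtractf algebra_simps)
    also have "\<dots> \<le> (max_singular_value W)\<^sup>2 * (\<Sum>k<C. ((X - Y) $$ (i, k))\<^sup>2)"
      by (rule sv(2))
    also have "\<dots> \<le> s\<^sup>2 * (\<Sum>k<C. ((X - Y) $$ (i, k))\<^sup>2)"
      using sv(1) s by (intro mult_right_mono power_mono sum_nonneg) auto
    finally show "(\<Sum>j<C. ((X * W - Y * W) $$ (i, j))\<^sup>2) \<le> s\<^sup>2 * (\<Sum>j<C. ((X - Y) $$ (i, j))\<^sup>2)" .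
  qed (use X Y W \<open>0 \<le> s\<close> in auto)
  ultimately show "\<exists>Y'\<in>span_mats n C m u. frobenius_norm (X * W - Y') \<le> s * frobenius_norm (X - Y)"
    by blast
qed

text \<open>Columns are compared in the eigenbasis \<open>q\<close>. The first \<open>m\<close>
  coordinates of the error vanish by the choice of the approximant, and the others are those of
  \<open>X - Y\<close> multiplied by \<open>d i\<close>, because \<open>Y\<close> has none
  there.\<close>

lemma dist_to_span_mult_left:
  assumes A: "A \<in> carrier_mat n n"
    and sym: "\<And>i j. i < n \<Longrightarrow> j < n \<Longrightarrow> A $$ (i, j) = A $$ (j, i)"
    and sys: "eigen_system n n (\<lambda>i j. A $$ (i, j)) q d"
    and m: "m \<le> n" and one: "\<And>i. i < m \<Longrightarrow> d i = 1"
    and bound: "\<And>i. m \<le> i \<Longrightarrow> i < n \<Longrightarrow> \<bar>d i\<bar> \<le> r" and "0 \<le> r"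
    and X: "X \<in> carrier_mat n C"
  shows "dist_to (span_mats n C m q) (A * X) \<le> r * dist_to (span_mats n C m q) X"
proof (rule dist_to_le_scale[OF span_mats_nonempty \<open>0 \<le> r\<close>])
  from sys have orth: "orthonormal n n q"
    and eig: "\<And>i k. i < n \<Longrightarrow> k < n \<Longrightarrow> matvec n (\<lambda>i j. A $$ (i, j)) (q i) k = d i * q i k"
    by (auto simp: eigen_system_def)
  define a where "a = (\<lambda>i j. A $$ (i, j))"
  have coeff_matvec: "ip n (q i) (matvec n a f) = d i * ip n (q i) f" if "i < n" for i f
  proof -
    have "ip n (q i) (matvec n a f) = ip n (matvec n a (q i)) f"
      using sym by (intro ip_matvec) (auto simp: a_def)
    also have "\<dots> = ip n (\<lambda>k. d i * q i k) f"
      using eig[OF that] by (intro ip_cong) (auto simp: a_def)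
    finally show ?thesis
      by (simp add: ip_scale_left)
  qed
  have coeff_span: "ip n (q i) (\<lambda>k. \<Sum>j<m. q j k * c j) = (if i < m then c i else 0)"
    if "i < n" for i c
  proof -
    have "ip n (q i) (\<lambda>k. \<Sum>j<m. q j k * c j) = (\<Sum>j<m. c j * ip n (q i) (q j))"
      by (simp add: ip_sum_right mult.commute[of "q _ _"] ip_scale_right)
    also have "\<dots> = (\<Sum>j<m. if j = i then c j else 0)"
      using orth m that by (intro sum.cong) (auto simp: orthonormal_def)
    finally show ?thesis by simp
  qed
  fix Y assume "Y \<in> span_mats n C m q"
  then obtain b where Y: "Y \<in> carrier_mat n C"
    and b: "\<And>k c. k < n \<Longrightarrow> c < C \<Longrightarrow> Y $$ (k, c) = (\<Sum>i<m. q i k * b i c)"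
    by (auto simp: span_mats_def)
  define x where "x c l = X $$ (l, c)" for c l
  \<comment> \<open>The projection of column \<open>c\<close> of \<open>X\<close> onto the span. As
    \<open>d i = 1\<close> for \<open>i < m\<close>, it is also the projection of column
    \<open>c\<close> of \<open>A * X\<close>.\<close>
  define z where "z c k = (\<Sum>i<m. q i k * ip n (q i) (x c))" for c k
  define Z where "Z = mat n C (\<lambda>(k, c). z c k)"
  have "Z \<in> span_mats n C m q"
    unfolding span_mats_def
    by (auto simp: Z_def z_def intro!: exI[of _ "\<lambda>i c. ip n (q i) (x c)"])
  moreover have "frobenius_norm (A * X - Z) \<le> r * frobenius_norm (X - Y)"
  proof (rule frobenius_norm_le_cols)
    fix c assume c: "c < C"
    \<comment> \<open>\<open>f\<close> and \<open>g\<close> are the columns \<open>c\<close> of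
      \<open>X - Y\<close> and of \<open>A * X - Z\<close>.\<close>
    define f where "f k = x c k - (\<Sum>i<m. q i k * b i c)" for k
    define g where "g k = matvec n a (x c) k - z c k" for k
    have "(ip n (q i) g)\<^sup>2 \<le> r\<^sup>2 * (ip n (q i) f)\<^sup>2" if i: "i < n" for i
    proof (cases "i < m")
      case True
      then have "ip n (q i) g = 0"
        unfolding g_def z_def using i one by (simp add: ip_diff_right coeff_matvec coeff_span)
      then show ?thesis by simp
    next
      case False
      then have "ip n (q i) g = d i * ip n (q i) f"
        unfolding g_def z_def f_def using i by (simp add: ip_diff_right coeff_matvec coeff_span)
      moreover have "(d i)\<^sup>2 \<le> r\<^sup>2"
        using bound[of i] False i \<open>0 \<le> r\<close> by (simp flip: abs_le_square_iff)
      ultimately show ?thesis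
        by (simp add: power_mult_distrib mult_right_mono)
    qed
    then have "ip n g g \<le> r\<^sup>2 * ip n f f"
      unfolding parseval[OF orth, of g g] parseval[OF orth, of f f] sum_distrib_left
      by (intro sum_mono) (simp add: power2_eq_square)
    moreover have "(\<Sum>i<n. ((A * X - Z) $$ (i, c))\<^sup>2) = ip n g g"
      using A X c by (simp add: ip_def g_def matvec_def a_def x_def Z_def scalar_prod_def
          atLeast0LessThan power2_eq_square)
    moreover have "(\<Sum>i<n. ((X - Y) $$ (i, c))\<^sup>2) = ip n f f"
      using X Y c by (simp add: ip_def f_def x_def b power2_eq_square)
    ultimately show "(\<Sum>i<n. ((A * X - Z) $$ (i, c))\<^sup>2) \<le> r\<^sup>2 * (\<Sum>i<n. ((X - Y) $$ (i, c))\<^sup>2)"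
      by simp
  qed (use A X Y \<open>0 \<le> r\<close> in \<open>auto simp: Z_def\<close>)
  ultimately show "\<exists>Y'\<in>span_mats n C m q. frobenius_norm (A * X - Y') \<le> r * frobenius_norm (X - Y)"
    by blast
qed

section \<open>Propagation matrix of a graph\<close>

text \<open>The components are classes of mutual reachability. Arcs come with their reversals, so
  the two ends of an arc reach each other and lie in the same component.\<close>

lemma connected_components_props:
  assumes G: "pair_pseudo_graph G" and S: "S \<in> connected_components G"
  shows "S \<noteq> {}" "S \<subseteq> pverts G"
    and "T \<in> connected_components G \<Longrightarrow> S \<noteq> T \<Longrightarrow> S \<inter> T = {}"
    and "(i, j) \<in> parcs G \<Longrightarrow> i \<in> S \<longleftrightarrow> j \<in> S"
proof -
  interpret pair_pseudo_graph G by (rule G)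
  have S': "S \<in> sccs_verts"
    using S by (simp add: connected_components_def)
  then have reach: "\<And>u v. u \<in> S \<Longrightarrow> v \<in> S \<Longrightarrow> u \<rightarrow>\<^sup>*\<^bsub>with_proj G\<^esub> v"
    and max: "\<And>u v. u \<in> S \<Longrightarrow> u \<rightarrow>\<^sup>*\<^bsub>with_proj G\<^esub> v \<Longrightarrow> v \<rightarrow>\<^sup>*\<^bsub>with_proj G\<^esub> u \<Longrightarrow> v \<in> S"
    by (auto simp: in_sccs_verts_conv_reachable)
  show "S \<noteq> {}"
    using S' by (simp add: in_sccs_verts_conv_reachable)
  show "S \<subseteq> pverts G"
    using reach reachable_in_verts(1) by blast
  show "S \<inter> T = {}" if "T \<in> connected_components G" "S \<noteq> T"
    using sccs_verts_disjoint[OF S' _ that(2)] that(1) by (simp add: connected_components_def)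
  have closed: "j \<in> S" if "(i, j) \<in> parcs G" "i \<in> S" for i j
  proof -
    have "(j, i) \<in> parcs G"
      using that(1) pair_sym_arcs by (simp add: symmetric_def symD)
    then show ?thesis
      using that by (intro max[of i j]) (auto intro: reachable_adjI)
  qed
  show "i \<in> S \<longleftrightarrow> j \<in> S" if "(i, j) \<in> parcs G"
    using closed[OF that] closed[of j i] that pair_sym_arcs by (auto simp: symmetric_def dest: symD)
qed

text \<open>Self-loops are allowed, so a diagonal entry may be 2.\<close>

definition aug_adj :: "nat pair_pre_digraph \<Rightarrow> nat \<Rightarrow> nat \<Rightarrow> real" where
  "aug_adj G i j = of_bool ((i, j) \<in> parcs G) + of_bool (i = j)"

definition aug_deg :: "nat pair_pre_digraph \<Rightarrow> nat \<Rightarrow> real" where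
  "aug_deg G i = real (deg G i) + 1"

lemma aug_deg_pos: "0 < aug_deg G i"
  by (simp add: aug_deg_def add_pos_nonneg add.commute)

lemma aug_adj_nonneg: "0 \<le> aug_adj G i j"
  by (simp add: aug_adj_def)

lemma aug_adj_sym: "pair_pseudo_graph G \<Longrightarrow> aug_adj G i j = aug_adj G j i"
  by (auto simp: aug_adj_def pair_pseudo_graph_def pair_sym_digraph_def pair_sym_digraph_axioms_def
      symmetric_def dest: symD)

text \<open>A self-loop is counted once in the degree and once in the row sum, and the added
  identity accounts for the 1 in \<open>aug_deg\<close>.\<close>

lemma sum_aug_adj:
  assumes "pverts G = {0..<N}" "i < N"
  shows "(\<Sum>j<N. aug_adj G i j) = aug_deg G i"
proof -
  have "{..<N} \<inter> {j. (i, j) \<in> parcs G} = {j \<in> pverts G. (i, j) \<in> parcs G}"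
    using assms by auto
  moreover have "{..<N} \<inter> {j. i = j} = {i}"
    using assms by auto
  ultimately show ?thesis
    by (simp add: aug_adj_def aug_deg_def deg_def sum.distrib sum_of_bool_eq)
qed

lemma diag_powr_aug_deg_mat:
  "diag_powr (aug_deg_mat N G) p = mat_diag N (\<lambda>i. aug_deg G i powr p)"
  by (auto simp: diag_powr_def aug_deg_mat_def deg_mat_def mat_diag_def aug_deg_def)

lemma prop_mat_carrier: "prop_mat N G \<in> carrier_mat N N"
  by (auto simp: prop_mat_def diag_powr_aug_deg_mat aug_adj_mat_def adj_mat_def
      intro!: mult_carrier_mat[of _ N N])

lemma prop_mat_entry:
  assumes "i < N" "j < N"
  shows "prop_mat N G $$ (i, j) = aug_adj G i j / (sqrt (aug_deg G i) * sqrt (aug_deg G j))"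
proof -
  have powr: "aug_deg G k powr - (1 / 2) = 1 / sqrt (aug_deg G k)" for k
    using aug_deg_pos[of G k] powr_minus_divide[of "aug_deg G k" "1 / 2"] by (simp add: powr_half_sqrt)
  have A: "aug_adj_mat N G \<in> carrier_mat N N"
    by (simp add: aug_adj_mat_def adj_mat_def)
  have "prop_mat N G $$ (i, j)
      = aug_deg G i powr (- 1 / 2) * aug_adj_mat N G $$ (i, j) * aug_deg G j powr (- 1 / 2)"
    unfolding prop_mat_def diag_powr_aug_deg_mat mat_diag_mult_left[OF A]
    by (subst mat_diag_mult_right[of _ N]) (use assms in auto)
  moreover have "aug_adj_mat N G $$ (i, j) = aug_adj G i j"
    using assms by (simp add: aug_adj_mat_def adj_mat_def aug_adj_def)
  ultimately show ?thesis
    by (simp add: powr)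
qed

lemma prop_mat_sym:
  assumes "pair_pseudo_graph G" "i < N" "j < N"
  shows "prop_mat N G $$ (i, j) = prop_mat N G $$ (j, i)"
  using assms by (simp add: prop_mat_entry aug_adj_sym[of G i j] mult.commute)

lemma dim_comp_vec: "dim_vec (comp_vec N G S) = N"
  by (simp add: comp_vec_def diag_powr_aug_deg_mat mat_diag_def)

lemma comp_vec_entry:
  assumes "k < N"
  shows "comp_vec N G S $ k = of_bool (k \<in> S) * sqrt (aug_deg G k)"
proof -
  have "comp_vec N G S $ k = (\<Sum>l<N. (if k = l then aug_deg G l powr (1 / 2) else 0) * of_bool (l \<in> S))"
    using assms by (simp add: comp_vec_def diag_powr_aug_deg_mat mat_diag_def indicator_vec_def
        scalar_prod_def atLeast0LessThan of_bool_def)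
  also have "\<dots> = (\<Sum>l<N. if l = k then of_bool (k \<in> S) * sqrt (aug_deg G k) else 0)"
    using aug_deg_pos[of G k] by (intro sum.cong) (auto simp: powr_half_sqrt less_imp_le)
  finally show ?thesis
    using assms by simp
qed

section \<open>Spectrum of the propagation matrix\<close>

text \<open>After the substitution \<open>g = D^(-1/2) v\<close>, with \<open>D\<close> the
  augmented degree matrix, the Rayleigh quotient is the quadratic form of \<open>aug_adj\<close> at
  \<open>g\<close>. Bounding each product by the mean of the squares leaves row sums, that is
  degrees, and the total is \<open>ip N v v\<close>.\<close>

lemma eigenvalue_prop_mat_le_1:
  assumes G: "pair_pseudo_graph G" "pverts G = {0..<N}"
    and v: "ip N v v = 1"
    and eig: "\<And>k. k < N \<Longrightarrow> matvec N (\<lambda>i j. prop_mat N G $$ (i, j)) v k = \<mu> * v k"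
  shows "\<mu> \<le> 1"
proof -
  define g where "g k = v k / sqrt (aug_deg G k)" for k
  have g: "aug_deg G k * (g k)\<^sup>2 = v k * v k" for k
    using aug_deg_pos[of G k] by (simp add: g_def power_divide power2_eq_square)
  have "\<mu> = ip N v (\<lambda>k. \<mu> * v k)"
    by (simp add: ip_scale_right v)
  also have "\<dots> = ip N v (matvec N (\<lambda>i j. prop_mat N G $$ (i, j)) v)"
    using eig by (intro ip_cong) auto
  also have "\<dots> = (\<Sum>i<N. \<Sum>j<N. aug_adj G i j * (g i * g j))"
    by (simp add: ip_def matvec_def sum_distrib_left prop_mat_entry g_def field_simps)
  also have "\<dots> \<le> (\<Sum>i<N. \<Sum>j<N. aug_adj G i j * (((g i)\<^sup>2 + (g j)\<^sup>2) / 2))"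
  proof (intro sum_mono mult_left_mono aug_adj_nonneg)
    show "g i * g j \<le> ((g i)\<^sup>2 + (g j)\<^sup>2) / 2" for i j
      using sum_squares_bound[of "g i" "g j"] by simp
  qed
  also have "\<dots> = ((\<Sum>i<N. \<Sum>j<N. aug_adj G i j * (g i)\<^sup>2) + (\<Sum>i<N. \<Sum>j<N. aug_adj G i j * (g j)\<^sup>2)) / 2"
    by (simp add: sum.distrib sum_divide_distrib distrib_left add_divide_distrib)
  also have "(\<Sum>i<N. \<Sum>j<N. aug_adj G i j * (g j)\<^sup>2) = (\<Sum>i<N. \<Sum>j<N. aug_adj G i j * (g i)\<^sup>2)"
    by (subst sum.swap) (simp add: aug_adj_sym[OF G(1)])
  also have "(\<Sum>i<N. \<Sum>j<N. aug_adj G i j * (g i)\<^sup>2) = (\<Sum>i<N. aug_deg G i * (g i)\<^sup>2)"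
    by (simp add: sum_aug_adj[OF G(2)] flip: sum_distrib_right)
  also have "\<dots> = 1"
    using v by (simp add: g ip_def)
  finally show ?thesis by simp
qed

text \<open>The vector \<open>e_m\<close> of the component \<open>S\<close>, divided by its
  Euclidean length.\<close>

definition unit_comp :: "nat pair_pre_digraph \<Rightarrow> nat set \<Rightarrow> nat \<Rightarrow> real" where
  "unit_comp G S k = of_bool (k \<in> S) * sqrt (aug_deg G k) / sqrt (\<Sum>l\<in>S. aug_deg G l)"

lemma matvec_prop_mat_unit_comp:
  assumes G: "pair_pseudo_graph G" "pverts G = {0..<N}"
    and S: "S \<in> connected_components G" and k: "k < N"
  shows "matvec N (\<lambda>i j. prop_mat N G $$ (i, j)) (unit_comp G S) k = unit_comp G S k"
proof -
  define r where "r = sqrt (\<Sum>l\<in>S. aug_deg G l)"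
  have pos: "0 < sqrt (aug_deg G j)" for j
    using aug_deg_pos[of G j] by simp
  have "matvec N (\<lambda>i j. prop_mat N G $$ (i, j)) (unit_comp G S) k
      = (\<Sum>j<N. aug_adj G k j * (of_bool (k \<in> S) / (sqrt (aug_deg G k) * r)))"
    unfolding matvec_def
  proof (intro sum.cong refl)
    fix j assume "j \<in> {..<N}"
    \<comment> \<open>A nonzero entry joins nodes of the same component, so membership of
      \<open>j\<close> can be replaced by that of \<open>k\<close>, and a plain row sum
      remains.\<close>
    moreover have "aug_adj G k j = 0 \<or> (k \<in> S \<longleftrightarrow> j \<in> S)"
      using connected_components_props(4)[OF G(1) S] by (auto simp: aug_adj_def)
    ultimately show "prop_mat N G $$ (k, j) * unit_comp G S j
        = aug_adj G k j * (of_bool (k \<in> S) / (sqrt (aug_deg G k) * r))"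
      using pos[of j] k by (auto simp: prop_mat_entry unit_comp_def r_def)
  qed
  also have "\<dots> = aug_deg G k * (of_bool (k \<in> S) / (sqrt (aug_deg G k) * r))"
    by (simp only: sum_distrib_right[symmetric] sum_aug_adj[OF G(2) k])
  also have "\<dots> = unit_comp G S k"
  proof -
    have "aug_deg G k = sqrt (aug_deg G k) * sqrt (aug_deg G k)"
      using aug_deg_pos[of G k] by simp
    then have "aug_deg G k / sqrt (aug_deg G k) = sqrt (aug_deg G k)"
      using pos[of k] by (metis less_irrefl nonzero_mult_div_cancel_left)
    then show ?thesis
      by (simp add: unit_comp_def r_def flip: divide_divide_eq_left)
  qed
  finally show ?thesis .
qed

lemma component_volume_pos:
  assumes G: "pair_pseudo_graph G" "S \<in> connected_components G"
  shows "0 < (\<Sum>l\<in>S. aug_deg G l)"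
proof (rule sum_pos)
  show "finite S"
    using connected_components_props(2)[OF G] G(1)
    by (meson finite_subset pair_fin_digraph.pair_finite_verts pair_pseudo_graph_def)
qed (use connected_components_props(1)[OF G] aug_deg_pos in auto)

text \<open>Distinct components are disjoint, which makes their vectors orthogonal.
  \<open>Suc i\<close> reconciles components numbered from 1 with families indexed from 0.\<close>

lemma eigen_system_components:
  assumes G: "pair_pseudo_graph G" "pverts G = {0..<N}"
    and V: "bij_betw V {1..M} (connected_components G)"
  shows "eigen_system N M (\<lambda>i j. prop_mat N G $$ (i, j)) (\<lambda>i. unit_comp G (V (Suc i))) (\<lambda>_. 1)"
  unfolding eigen_system_def orthonormal_def
proof (intro conjI allI impI)
  have VS: "V (Suc i) \<in> connected_components G" if "i < M" for i
    using V that by (auto simp: bij_betw_def)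
  fix i assume i: "i < M"
  show "matvec N (\<lambda>i j. prop_mat N G $$ (i, j)) (unit_comp G (V (Suc i))) k = 1 * unit_comp G (V (Suc i)) k"
    if "k < N" for k
    using matvec_prop_mat_unit_comp[OF G VS[OF i] that] by simp
  fix j assume j: "j < M"
  show "ip N (unit_comp G (V (Suc i))) (unit_comp G (V (Suc j))) = of_bool (i = j)"
  proof (cases "i = j")
    case True
    define S where "S = V (Suc i)"
    define c where "c = (\<Sum>l\<in>S. aug_deg G l)"
    have c: "c > 0"
      unfolding c_def S_def using component_volume_pos[OF G(1) VS[OF i]] .
    have "S \<subseteq> {..<N}"
      using connected_components_props(2)[OF G(1) VS[OF i]] G(2) by (auto simp: S_def)
    then have "{..<N} \<inter> S = S" by auto
    have "ip N (unit_comp G S) (unit_comp G S) = (\<Sum>l<N. if l \<in> S then aug_deg G l / c else 0)"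
      unfolding ip_def using c aug_deg_pos[THEN less_imp_le]
      by (intro sum.cong) (auto simp: unit_comp_def c_def)
    also have "\<dots> = (\<Sum>l\<in>S. aug_deg G l / c)"
      using \<open>{..<N} \<inter> S = S\<close> by (simp flip: sum.inter_restrict)
    also have "\<dots> = 1"
      using c by (simp add: c_def flip: sum_divide_distrib)
    finally show ?thesis
      using True by (simp add: S_def)
  next
    case False
    then have "V (Suc i) \<noteq> V (Suc j)"
      using V i j inj_on_eq_iff[of V "{1..M}" "Suc i" "Suc j"] by (simp add: bij_betw_def)
    then have "V (Suc i) \<inter> V (Suc j) = {}"
      using connected_components_props(3)[OF G(1) VS[OF i] VS[OF j]] by blast
    then have "ip N (unit_comp G (V (Suc i))) (unit_comp G (V (Suc j))) = (\<Sum>k<N. 0)"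
      unfolding ip_def by (intro sum.cong) (auto simp: unit_comp_def)
    with False show ?thesis by simp
  qed
qed

text \<open>Normalizing \<open>e_m\<close> only rescales its coefficient row by the length
  \<open>r i\<close>, which is nonzero.\<close>

lemma inv_space_eq_span:
  assumes G: "pair_pseudo_graph G"
    and V: "bij_betw V {1..M} (connected_components G)"
  shows "inv_space N G M V C = span_mats N C M (\<lambda>i. unit_comp G (V (Suc i)))"
proof -
  define r where "r i = sqrt (\<Sum>l\<in>V (Suc i). aug_deg G l)" for i
  have r: "r i > 0" if "i < M" for i
    using component_volume_pos[OF G bij_betw_apply[OF V, of "Suc i"]] that by (simp add: r_def)
  have entry: "(\<Sum>m = 1..M. tensor (comp_vec N G (V m)) (w m) $$ (k, c))
      = (\<Sum>i<M. unit_comp G (V (Suc i)) k * (r i * w (Suc i) $ c))"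
    if "k < N" "c < C" "\<forall>m\<in>{1..M}. w m \<in> carrier_vec C" for k c w
  proof -
    have "(\<Sum>m = 1..M. tensor (comp_vec N G (V m)) (w m) $$ (k, c))
        = (\<Sum>m = 1..M. comp_vec N G (V m) $ k * w m $ c)"
    proof (intro sum.cong refl)
      fix m assume "m \<in> {1..M}"
      with that(3) have "dim_vec (w m) = C" by auto
      with that(1,2) show "tensor (comp_vec N G (V m)) (w m) $$ (k, c) = comp_vec N G (V m) $ k * w m $ c"
        by (simp add: tensor_def dim_comp_vec)
    qed
    also have "\<dots> = (\<Sum>i<M. comp_vec N G (V (Suc i)) $ k * w (Suc i) $ c)"
      by (simp add: sum.atLeast1_atMost_eq)
    also have "\<dots> = (\<Sum>i<M. unit_comp G (V (Suc i)) k * (r i * w (Suc i) $ c))"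
    proof (intro sum.cong refl)
      fix i assume "i \<in> {..<M}"
      then have "comp_vec N G (V (Suc i)) $ k = unit_comp G (V (Suc i)) k * r i"
        using r[of i] that(1) by (simp add: comp_vec_entry unit_comp_def flip: r_def)
      then show "comp_vec N G (V (Suc i)) $ k * w (Suc i) $ c
          = unit_comp G (V (Suc i)) k * (r i * w (Suc i) $ c)"
        by simp
    qed
    finally show ?thesis .
  qed
  show ?thesis
  proof (intro equalityI subsetI)
    fix Y assume "Y \<in> inv_space N G M V C"
    then obtain w where w: "\<forall>m\<in>{1..M}. w m \<in> carrier_vec C"
      and Y: "Y = mat N C (\<lambda>(k, c). \<Sum>m = 1..M. tensor (comp_vec N G (V m)) (w m) $$ (k, c))"
      unfolding inv_space_def by blast
    show "Y \<in> span_mats N C M (\<lambda>i. unit_comp G (V (Suc i)))"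
      unfolding span_mats_def using entry[OF _ _ w]
      by (auto simp: Y intro!: exI[of _ "\<lambda>i c. r i * w (Suc i) $ c"])
  next
    fix Y assume "Y \<in> span_mats N C M (\<lambda>i. unit_comp G (V (Suc i)))"
    then obtain b where Y: "Y \<in> carrier_mat N C"
      and b: "\<And>k c. k < N \<Longrightarrow> c < C \<Longrightarrow>
        Y $$ (k, c) = (\<Sum>i<M. unit_comp G (V (Suc i)) k * b i c)"
      by (auto simp: span_mats_def)
    \<comment> \<open>Dividing by the length undoes the normalization; \<open>m - 1\<close> undoes
      the shift of the numbering.\<close>
    define w where "w m = vec C (\<lambda>c. b (m - 1) c / r (m - 1))" for m
    have w: "\<forall>m\<in>{1..M}. w m \<in> carrier_vec C"
      by (simp add: w_def)
    have "(\<Sum>m = 1..M. tensor (comp_vec N G (V m)) (w m) $$ (k, c)) = Y $$ (k, c)"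
      if "k < N" "c < C" for k c
    proof -
      have "r i * w (Suc i) $ c = b i c" if "i < M" for i
        using r[OF that] \<open>c < C\<close> by (simp add: w_def)
      then show ?thesis
        unfolding entry[OF that w] using that by (simp add: b)
    qed
    then have "Y = mat N C (\<lambda>(k, c). \<Sum>m = 1..M. tensor (comp_vec N G (V m)) (w m) $$ (k, c))"
      using Y by (intro eq_matI) auto
    with w show "Y \<in> inv_space N G M V C"
      unfolding inv_space_def by blast
  qed
qed

section \<open>Contraction\<close>

lemma gcn_layer_carrier:
  assumes "P \<in> carrier_mat N N" "\<forall>l\<ge>1. W l \<in> carrier_mat C C" "X \<in> carrier_mat N C"
  shows "gcn_layer P W X l \<in> carrier_mat N C"
proof (induction l)
  case (Suc l)
  then show ?case
    using assms(1) assms(2)[rule_format, of "Suc l"] by (simp add: relu_def)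
qed (simp add: assms)

theorem theorem2:
  fixes G :: "nat pair_pre_digraph"
    and N M C :: nat
    and V :: "nat \<Rightarrow> nat set"
    and P :: "real mat"
    and W :: "nat \<Rightarrow> real mat"
    and s lam :: real
    and MM :: "real mat set"
  assumes graph: "pair_pseudo_graph G" "pverts G = {0..<N}"
    and components: "bij_betw V {1..M} (connected_components G)"
    and P: "P = prop_mat N G"
    and lam: "lam = (if M = N then 0 else Max ((\<lambda>n. \<bar>nth_eigenvalue P n\<bar>) ` {1..N - M}))"
    and C: "C > 0"
    and W: "\<forall>l\<ge>1. W l \<in> carrier_mat C C"
    and bounded: "bdd_above ((\<lambda>l. max_singular_value (W l)) ` {1..})"
    and s: "s = (SUP l\<in>{1..}. max_singular_value (W l))"
    and MM: "MM = inv_space N G M V C"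
  shows "length (eigenvalue_list P) = N \<and>
    (\<forall>n\<in>{N - M + 1..N}. nth_eigenvalue P n = 1) \<and>
    (\<forall>X\<in>carrier_mat N C.
      (\<forall>l. dist_to MM (gcn_layer P W X l) \<le> (s * lam) ^ l * dist_to MM X) \<and>
      (s * lam < 1 \<longrightarrow>
        (\<lambda>l. dist_to MM (gcn_layer P W X l)) \<longlonglongrightarrow> 0 \<and>
        (\<exists>K q. 0 < q \<and> q < 1 \<and> (\<forall>l. dist_to MM (gcn_layer P W X l) \<le> K * q ^ l))))"
proof -
  define u where "u i = unit_comp G (V (Suc i))" for i
  have sys: "eigen_system N M (\<lambda>i j. P $$ (i, j)) u (\<lambda>_. 1)"
    unfolding u_def P by (rule eigen_system_components[OF graph components])
  have PN: "P \<in> carrier_mat N N"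
    unfolding P by (rule prop_mat_carrier)
  have sym: "P $$ (i, j) = P $$ (j, i)" if "i < N" "j < N" for i j
    unfolding P by (rule prop_mat_sym[OF graph(1) that])
  \<comment> \<open>The component vectors, all with eigenvalue 1, become the first \<open>M\<close>
    members of a full eigenbasis of \<open>P\<close>.\<close>
  obtain q d where full: "eigen_system N N (\<lambda>i j. P $$ (i, j)) q d"
    and qu: "\<And>i. i < M \<Longrightarrow> q i = u i" and d1: "\<And>i. i < M \<Longrightarrow> d i = 1"
    by (rule eigen_system_extend[OF _ sys]) (use sym in auto)
  have MN: "M \<le> N"
    using sys orthonormal_le_dim by (auto simp: eigen_system_def)
  have dle: "d i \<le> 1" if "i < N" for i
    using full that unfolding eigen_system_def orthonormal_def P
    by (intro eigenvalue_prop_mat_le_1[OF graph, of "q i"]) auto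
  define es where "es = sort (map d [M..<N])"
  have ev: "eigenvalue_list P = es @ replicate M 1"
    unfolding es_def eigenvalue_list_eigen_system[OF PN full]
    by (rule sort_split_top) (use MN d1 dle in auto)
  have len: "length es = N - M"
    by (simp add: es_def)
  \<comment> \<open>Position \<open>n\<close> of \<open>es\<close>, counted from 0, carries the
    number \<open>Suc n\<close> among the eigenvalues, which lies in the range of the
    maximum.\<close>
  have dlam: "\<bar>d i\<bar> \<le> lam" if "M \<le> i" "i < N" for i
  proof -
    have "d i \<in> set es"
      using that by (simp add: es_def)
    then obtain n where n: "n < N - M" "es ! n = d i"
      by (auto simp: in_set_conv_nth len)
    then have "nth_eigenvalue P (Suc n) = d i"
      by (simp add: nth_eigenvalue_def ev nth_append len)
    then have "\<bar>d i\<bar> \<in> (\<lambda>n. \<bar>nth_eigenvalue P n\<bar>) ` {1..N - M}"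
      using n(1) by (intro image_eqI[of _ _ "Suc n"]) auto
    with that show ?thesis
      by (simp add: lam)
  qed
  \<comment> \<open>For \<open>M < N\<close> the number \<open>lam\<close> bounds an absolute value;
    for \<open>M = N\<close> it is the default 0.\<close>
  have lam0: "0 \<le> lam"
  proof (cases "M = N")
    case False
    with MN dlam[of M] show ?thesis by simp
  qed (simp add: lam)
  have sl: "max_singular_value (W l) \<le> s" if "l \<ge> 1" for l
    unfolding s using that bounded by (intro cSUP_upper) auto
  have s0: "0 \<le> s"
    using max_singular_value_bound(1)[OF _ C, of "W 1"] W sl[of 1] by simp
  have MMu: "MM = span_mats N C M u"
    unfolding MM u_def by (rule inv_space_eq_span[OF graph(1) components])
  \<comment> \<open>Both descriptions of the space are used: \<open>u\<close> with its explicit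
    disjoint supports for ReLU, and \<open>q\<close> with its completion to an eigenbasis for
    \<open>P\<close>.\<close>
  have MMq: "MM = span_mats N C M q"
    unfolding MMu by (rule span_mats_cong) (simp add: qu)
  have step: "dist_to MM (relu (P * X * W l)) \<le> s * lam * dist_to MM X"
    if X: "X \<in> carrier_mat N C" and l: "l \<ge> 1" for X l
  proof -
    have Wl: "W l \<in> carrier_mat C C" and PX: "P * X \<in> carrier_mat N C"
      using W l PN X by auto
    have "dist_to MM (relu (P * X * W l)) \<le> dist_to MM (P * X * W l)"
      unfolding MMu
    proof (rule dist_to_span_relu)
      show "0 \<le> u i k" if "i < M" for i k
        using aug_deg_pos[THEN less_imp_le] by (simp add: u_def unit_comp_def sum_nonneg)
      show "i = j" if "i < M" "j < M" "u i k \<noteq> 0" "u j k \<noteq> 0" for i j k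
      proof (rule ccontr)
        assume "i \<noteq> j"
        then have "V (Suc i) \<noteq> V (Suc j)"
          using components that inj_on_eq_iff[of V "{1..M}" "Suc i" "Suc j"]
          by (simp add: bij_betw_def)
        then have "V (Suc i) \<inter> V (Suc j) = {}"
          using that by (intro connected_components_props(3)[OF graph(1)]
              bij_betw_apply[OF components]) auto
        with that show False
          by (auto simp: u_def unit_comp_def)
      qed
    qed (use PX Wl in auto)
    also have "\<dots> \<le> s * dist_to MM (P * X)"
      unfolding MMu by (rule dist_to_span_mult_right[OF PX Wl C sl[OF l]])
    also have "\<dots> \<le> s * (lam * dist_to MM X)"
      unfolding MMq using s0
      by (intro mult_left_mono dist_to_span_mult_left[OF PN sym full MN d1 dlam lam0 X])
    finally show ?thesis by (simp add: mult.assoc)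
  qed
  have main: "dist_to MM (gcn_layer P W X l) \<le> (s * lam) ^ l * dist_to MM X"
    if X: "X \<in> carrier_mat N C" for X l
  proof (induction l)
    case (Suc l)
    have "dist_to MM (gcn_layer P W X (Suc l)) \<le> s * lam * dist_to MM (gcn_layer P W X l)"
      using step[OF gcn_layer_carrier[OF PN W X], of "Suc l"] by simp
    also have "\<dots> \<le> s * lam * ((s * lam) ^ l * dist_to MM X)"
      using Suc s0 lam0 by (intro mult_left_mono) auto
    finally show ?case by simp
  qed simp
  have decay: "(\<lambda>l. dist_to MM (gcn_layer P W X l)) \<longlonglongrightarrow> 0 \<and>
      (\<exists>K q. 0 < q \<and> q < 1 \<and> (\<forall>l. dist_to MM (gcn_layer P W X l) \<le> K * q ^ l))"
    if X: "X \<in> carrier_mat N C" and lt: "s * lam < 1" for X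
  proof
    have nonneg: "0 \<le> dist_to MM Y" for Y
      unfolding MMu by (rule dist_to_nonneg[OF span_mats_nonempty])
    have "(\<lambda>l. (s * lam) ^ l) \<longlonglongrightarrow> 0"
      using lt s0 lam0 by (intro LIMSEQ_realpow_zero) simp_all
    then have lim: "(\<lambda>l. (s * lam) ^ l * dist_to MM X) \<longlonglongrightarrow> 0"
      by (rule tendsto_mult_left_zero)
    show "(\<lambda>l. dist_to MM (gcn_layer P W X l)) \<longlonglongrightarrow> 0"
      by (rule tendsto_sandwich[OF _ _ tendsto_const lim]; intro always_eventually allI nonneg main X)
    \<comment> \<open>The maximum with \<open>1 / 2\<close> keeps the rate positive when
      \<open>s * lam = 0\<close>.\<close>
    define q where "q = max (s * lam) (1 / 2)"
    have "dist_to MM (gcn_layer P W X l) \<le> dist_to MM X * q ^ l" for l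
    proof -
      have "(s * lam) ^ l * dist_to MM X \<le> q ^ l * dist_to MM X"
        using s0 lam0 nonneg by (intro mult_right_mono power_mono) (auto simp: q_def)
      with main[OF X, of l] show ?thesis
        by (simp add: mult.commute)
    qed
    moreover have "0 < q" "q < 1"
      using lt by (auto simp: q_def)
    ultimately show "\<exists>K q. 0 < q \<and> q < 1 \<and> (\<forall>l. dist_to MM (gcn_layer P W X l) \<le> K * q ^ l)"
      by blast
  qed
  have "nth_eigenvalue P n = 1" if "n \<in> {N - M + 1..N}" for n
    using that MN by (auto simp: nth_eigenvalue_def ev nth_append len)
  moreover have "length (eigenvalue_list P) = N"
    using MN by (simp add: ev len)
  ultimately show ?thesis
    using main decay by blast
qed

end
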